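(* Let $m,n\ge 1$ be integers, let $f_1,\ldots,f_n\in\mathbb{Z}[X_1,\ldots,X_m]$, and let $S\subseteq\mathbb{Z}^m$. Assume that: (1) for all $1\le i<j\le n$, the polynomials $f_i$ and $f_j$ have no common zero in $\mathbb{C}^m$; (2) for each $1\le i\le n$, there are only finitely many $\boldsymbol{u}\in S$ with $f_i(\boldsymbol{u})=\pm1$ (i.e. $f_i(\boldsymbol u)\in\{1,-1\}$); (3) for all but at most one index $i\in\{1,\ldots,n\}$, $P^+(f_i(\boldsymbol{u}))\to\infty$ as $\max_{1\le l\le m}|u_l|\to\infty$ for $\boldsymbol{u}=(u_1,\ldots,u_m)\in S$. Then the set of $\boldsymbol{u}\in S$ such that $(f_1(\boldsymbol{u}),\ldots,f_n(\boldsymbol{u}))$ is multiplicatively dependent is finite.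
   Context: A vector $(\nu_1,\ldots,\nu_n)\in\mathbb{C}^n$ is called multiplicatively dependent if all its coordinates are non-zero and there is a non-zero vector $(k_1,\ldots,k_n)\in\mathbb{Z}^n$ with $\nu_1^{k_1}\cdots\nu_n^{k_n}=1$. For $x\in\mathbb{Z}$, $P^+(x)$ denotes the largest prime factor of $x$. Conventions: $P^+(\pm1)=1$, and $P^+(0)=+\infty$ (so points with $f_i(\boldsymbol{u})=0$ impose no restriction in the growth condition (3)). Condition (3) for an index $i$ means: for every $B>0$ there is $R>0$ such that $P^+(f_i(\boldsymbol{u}))>B$ for every $\boldsymbol{u}\in S$ with $\max_l|u_l|>R$. *)

theory Defs
  imports "HOL-Analysis.Analysis" "HOL-Library.Poly_Mapping" "HOL-Library.Extended_Nat"
    "HOL-Computational_Algebra.Primes"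
begin

text \<open>
  Polynomials with integer coefficients in the variables \<open>X\<^sub>l\<close>, where \<open>l\<close> ranges over the
  finite type \<open>'m\<close> (so the number of variables is \<open>CARD('m)\<close>): a finitely supported map from
  exponent vectors to coefficients.
\<close>

type_synonym 'm int_mpoly = "('m \<Rightarrow>\<^sub>0 nat) \<Rightarrow>\<^sub>0 int"

text \<open>
  The value ring is arbitrary, since the same polynomial is evaluated at integer points and at
  complex points.
\<close>

definition mpoly_eval :: "'m::finite int_mpoly \<Rightarrow> ('a::comm_ring_1)^'m \<Rightarrow> 'a" where
  "mpoly_eval p x =
     (\<Sum>t\<in>Poly_Mapping.keys p.
        of_int (Poly_Mapping.lookup p t) * (\<Prod>l\<in>UNIV. (x $ l) ^ Poly_Mapping.lookup t l))"

definition mult_dependent :: "complex^'n::finite \<Rightarrow> bool" where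
  "mult_dependent \<nu> \<longleftrightarrow>
     (\<forall>i. \<nu> $ i \<noteq> 0) \<and> (\<exists>k::int^'n. k \<noteq> 0 \<and> (\<Prod>i\<in>UNIV. (\<nu> $ i) powi (k $ i)) = 1)"

text \<open>
  \<open>P\<^sup>+(x)\<close>, with the conventions \<open>P\<^sup>+(0) = \<infinity>\<close> and \<open>P\<^sup>+(\<plusminus>1) = 1\<close>.
\<close>

definition largest_prime_factor :: "int \<Rightarrow> enat" where
  "largest_prime_factor x =
     (if x = 0 then \<infinity>
      else if \<bar>x\<bar> = 1 then 1
      else enat (Max {p::nat. prime p \<and> int p dvd x}))"

definition max_abs :: "int^'m::finite \<Rightarrow> int" where
  "max_abs u = Max (range (\<lambda>l. \<bar>u $ l\<bar>))"

text \<open>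
  \<open>P\<^sup>+(g(u)) \<rightarrow> \<infinity>\<close> as \<open>max\<^sub>l |u\<^sub>l| \<rightarrow> \<infinity>\<close> with \<open>u \<in> S\<close>.  It holds vacuously if \<open>S\<close> is finite.
\<close>

definition largest_prime_factor_tends_to_infinity ::
    "(int^'m::finite \<Rightarrow> int) \<Rightarrow> (int^'m) set \<Rightarrow> bool" where
  "largest_prime_factor_tends_to_infinity g S \<longleftrightarrow>
     (\<forall>B::nat. B > 0 \<longrightarrow>
        (\<exists>R::int. R > 0 \<and> (\<forall>u\<in>S. max_abs u > R \<longrightarrow> largest_prime_factor (g u) > enat B)))"

end

theory Submission
  imports Defs "HOL-Library.Function_Algebras"
    "HOL-Computational_Algebra.Fundamental_Theorem_Algebra"
begin

text \<open>
  If \<open>f\<^sub>i\<close> and \<open>f\<^sub>j\<close> have no common complex zero, then some integer \<open>N\<^sub>i\<^sub>j \<noteq> 0\<close> is divisible by every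
  common divisor of \<open>f\<^sub>i(u)\<close> and \<open>f\<^sub>j(u)\<close>, for all \<open>u\<close>. For \<open>u\<close> large, a good index \<open>i\<close>
  then has a prime \<open>p | f\<^sub>i(u)\<close> exceeding all \<open>N\<^sub>i\<^sub>j\<close>, so \<open>p\<close> divides no other coordinate and the
  exponent of \<open>f\<^sub>i(u)\<close> in a multiplicative relation is zero. The relation only involves the
  exceptional index, whose value must be \<open>\<plusminus>1\<close>.

  The integer \<open>N\<^sub>i\<^sub>j\<close> exists as soon as the ideal generated by \<open>f\<^sub>i\<close> and \<open>f\<^sub>j\<close> in the ring of all
  functions \<open>\<int>\<^sup>m \<rightarrow> \<int>\<close> contains a non-zero constant. Otherwise it extends to a prime ideal \<open>P\<close>
  without non-zero constants, and the subring generated by the coordinate functions modulo \<open>P\<close>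
  embeds into \<open>\<complex>\<close>: adjoin one coordinate at a time, sending it to a root of a
  relation of minimal degree if there is one, and otherwise to a number transcendental over the
  countable ring reached so far. The images of the coordinates form a common zero.
\<close>

section \<open>Polynomials over a subring\<close>

locale subring_of =
  fixes K :: "'a::idom set"
  assumes one_closed: "1 \<in> K"
    and diff_closed: "x \<in> K \<Longrightarrow> y \<in> K \<Longrightarrow> x - y \<in> K"
    and mult_closed: "x \<in> K \<Longrightarrow> y \<in> K \<Longrightarrow> x * y \<in> K"
begin

lemma zero_closed: "0 \<in> K"
  using diff_closed[OF one_closed one_closed] by simp

lemma add_closed: "x \<in> K \<Longrightarrow> y \<in> K \<Longrightarrow> x + y \<in> K"
  using diff_closed[of x "0 - y"] diff_closed[of 0 y] zero_closed by simp

lemma sum_closed: "(\<And>i. i \<in> I \<Longrightarrow> g i \<in> K) \<Longrightarrow> sum g I \<in> K"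
  by (induction I rule: infinite_finite_induct) (auto simp: zero_closed add_closed)

definition polys :: "'a poly set" where
  "polys = {p. \<forall>i. coeff p i \<in> K}"

lemma polys_diff: "p \<in> polys \<Longrightarrow> q \<in> polys \<Longrightarrow> p - q \<in> polys"
  by (simp add: polys_def diff_closed)

lemma polys_add: "p \<in> polys \<Longrightarrow> q \<in> polys \<Longrightarrow> p + q \<in> polys"
  by (simp add: polys_def add_closed)

lemma polys_mult: "p \<in> polys \<Longrightarrow> q \<in> polys \<Longrightarrow> p * q \<in> polys"
  by (simp add: polys_def coeff_mult sum_closed mult_closed)

lemma polys_smult: "c \<in> K \<Longrightarrow> p \<in> polys \<Longrightarrow> smult c p \<in> polys"
  by (simp add: polys_def mult_closed)

lemma polys_monom: "c \<in> K \<Longrightarrow> monom c n \<in> polys"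
  by (simp add: polys_def zero_closed)

lemma polys_const: "c \<in> K \<Longrightarrow> [:c:] \<in> polys"
  using polys_monom[of c 0] by (simp add: monom_0)

lemma countable_polys:
  assumes "countable K"
  shows "countable polys"
proof -
  have "polys \<subseteq> Poly ` lists K"
  proof
    fix p assume "p \<in> polys"
    then have "range (coeff p) \<subseteq> K"
      by (auto simp: polys_def)
    then have "coeffs p \<in> lists K"
      by (simp add: range_coeff in_listsI subset_iff)
    then show "p \<in> Poly ` lists K"
      by (metis Poly_coeffs imageI)
  qed
  then show ?thesis
    by (rule countable_subset) (simp add: assms)
qed

text \<open>The leading coefficient of \<open>h\<close> need not be invertible in \<open>K\<close>,
  so each step of the long division scales \<open>q\<close> by it; \<open>c\<close> collects these
  factors.\<close>

lemma pseudo_division: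
  assumes h: "h \<in> polys" "h \<noteq> 0" and "q \<in> polys"
  shows "\<exists>c a r. c \<in> K \<and> c \<noteq> 0 \<and> a \<in> polys \<and> r \<in> polys \<and> smult c q = a * h + r
    \<and> (r = 0 \<or> degree r < degree h)"
  using \<open>q \<in> polys\<close>
proof (induction "degree q" arbitrary: q rule: less_induct)
  case less
  show ?case
  proof (cases "q = 0 \<or> degree q < degree h")
    case True
    moreover have "(0::'a poly) \<in> polys"
      by (simp add: polys_def zero_closed)
    ultimately show ?thesis
      using less.prems one_closed by (intro exI[of _ 1] exI[of _ 0] exI[of _ q]) auto
  next
    case False
    \<comment> \<open>Scaling by \<open>l\<close> gives \<open>smult l q\<close> and
      \<open>m * h\<close> the same leading term, so their difference has smaller degree or is
      zero.\<close>
    define l where "l = lead_coeff h"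
    define m where "m = monom (lead_coeff q) (degree q - degree h)"
    define q' where "q' = smult l q - m * h"
    have l: "l \<in> K" "l \<noteq> 0"
      using h by (auto simp: l_def polys_def)
    have m: "m \<in> polys"
      unfolding m_def using less.prems by (intro polys_monom) (simp add: polys_def)
    have q': "q' \<in> polys"
      unfolding q'_def by (intro polys_diff polys_mult polys_smult m h l less.prems)
    have deg_mh: "degree (m * h) = degree q" "m \<noteq> 0"
      using False h by (auto simp: m_def degree_mult_eq degree_monom_eq monom_eq_0_iff)
    have "coeff q' (degree q) = 0"
    proof -
      have "coeff (m * h) (degree m + degree h) = lead_coeff m * lead_coeff h"
        by (rule coeff_mult_degree_sum)
      moreover have "degree m + degree h = degree q" "lead_coeff m = lead_coeff q"
        using False by (auto simp: m_def degree_monom_eq)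
      ultimately show ?thesis
        by (simp add: q'_def l_def mult.commute)
    qed
    moreover have "degree q' \<le> degree q"
      unfolding q'_def using deg_mh by (intro degree_diff_le) (auto intro: degree_smult_le)
    ultimately have q'_cases: "q' = 0 \<or> degree q' < degree q"
      by (metis leading_coeff_0_iff le_neq_implies_less)
    show ?thesis
    proof (cases "q' = 0")
      case True
      moreover have "(0::'a poly) \<in> polys"
        by (simp add: polys_def zero_closed)
      ultimately show ?thesis
        using l m by (intro exI[of _ l] exI[of _ m] exI[of _ 0]) (auto simp: q'_def)
    next
      case False
      then obtain c a r where car: "c \<in> K" "c \<noteq> 0" "a \<in> polys" "r \<in> polys"
          "smult c q' = a * h + r" "r = 0 \<or> degree r < degree h"
        using less.hyps[of q'] q' q'_cases by blast
      have "smult (c * l) q = (smult c m + a) * h + r"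
        using car(5) by (simp add: q'_def algebra_simps smult_diff_right)
      moreover have "c * l \<in> K" "c * l \<noteq> 0" "smult c m + a \<in> polys"
        using car l m by (auto intro: mult_closed polys_add polys_smult)
      ultimately show ?thesis
        using car by blast
    qed
  qed
qed

text \<open>The pseudo-remainder of \<open>q\<close> by \<open>h\<close> stays in \<open>T\<close>,
  and minimality of \<open>degree h\<close> forces it to vanish. Up to non-zero constants,
  \<open>h\<close> generates \<open>T\<close>.\<close>

lemma minimal_degree_divides:
  assumes T: "T \<subseteq> polys"
    and diff: "\<And>p q. p \<in> T \<Longrightarrow> q \<in> T \<Longrightarrow> p - q \<in> T"
    and mult: "\<And>p q. p \<in> polys \<Longrightarrow> q \<in> T \<Longrightarrow> p * q \<in> T"
    and h: "h \<in> T" "h \<noteq> 0" "\<And>p. p \<in> T \<Longrightarrow> p \<noteq> 0 \<Longrightarrow> degree h \<le> degree p"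
    and q: "q \<in> T"
  shows "\<exists>c a. c \<in> K \<and> c \<noteq> 0 \<and> a \<in> polys \<and> smult c q = a * h"
proof -
  obtain c a r where car: "c \<in> K" "c \<noteq> 0" "a \<in> polys" "smult c q = a * h + r"
      "r = 0 \<or> degree r < degree h"
    using pseudo_division[of h q] h(1,2) q T by (metis subsetD)
  have "r = [:c:] * q - a * h"
    using car by simp
  also have "\<dots> \<in> T"
    using car h q by (intro diff mult polys_const)
  finally have "r = 0"
    using h(3)[of r] car(5) by (metis linorder_not_le)
  then show ?thesis
    using car by auto
qed

end

lemma ex_minimal_degree:
  assumes "\<exists>p\<in>T. p \<noteq> 0"
  shows "\<exists>h\<in>T. h \<noteq> 0 \<and> (\<forall>p\<in>T. p \<noteq> 0 \<longrightarrow> degree h \<le> degree p)"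
  using assms ex_has_least_nat[of "\<lambda>p. p \<in> T \<and> p \<noteq> 0" _ degree] by blast

text \<open>\<open>T\<close> plays the role of the relations satisfied by a new element over
  \<open>K\<close>. If it is zero, \<open>z\<close> is transcendental over \<open>K\<close>;
  otherwise any root of a minimal-degree relation serves.\<close>

lemma prime_ideal_eq_vanishing_polys:
  fixes K :: "complex set"
  assumes "subring_of K" "countable K"
    and T: "T \<subseteq> subring_of.polys K" "0 \<in> T"
    and diff: "\<And>p q. p \<in> T \<Longrightarrow> q \<in> T \<Longrightarrow> p - q \<in> T"
    and mult: "\<And>p q. p \<in> subring_of.polys K \<Longrightarrow> q \<in> T \<Longrightarrow> p * q \<in> T"
    and prime: "\<And>p q. p \<in> subring_of.polys K \<Longrightarrow> q \<in> subring_of.polys K \<Longrightarrow>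
      p * q \<in> T \<Longrightarrow> p \<in> T \<or> q \<in> T"
    and const: "\<And>c. [:c:] \<in> T \<Longrightarrow> c = 0"
  shows "\<exists>z. \<forall>q\<in>subring_of.polys K. q \<in> T \<longleftrightarrow> poly q z = 0"
proof -
  interpret subring_of K by fact
  show ?thesis
  proof (cases "\<exists>p\<in>T. p \<noteq> 0")
    case False
    \<comment> \<open>Countably many non-zero polynomials with finitely many roots each cannot
      exhaust \<complex>.\<close>
    have "countable (\<Union>p\<in>polys - {0}. {z. poly p z = 0})"
      using countable_polys[OF \<open>countable K\<close>]
      by (intro countable_UN) (auto intro!: countable_finite poly_roots_finite)
    then obtain z where "z \<notin> (\<Union>p\<in>polys - {0}. {z. poly p z = 0})"
      using uncountable_UNIV_complex by (metis UNIV_eq_I)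
    then show ?thesis
      using False T(2) by (intro exI[of _ z]) auto
  next
    case True
    then obtain h where h: "h \<in> T" "h \<noteq> 0" "\<And>p. p \<in> T \<Longrightarrow> p \<noteq> 0 \<Longrightarrow> degree h \<le> degree p"
      using ex_minimal_degree[of T] by blast
    have "degree h \<noteq> 0"
      using h const by (metis degree_eq_zeroE pCons_0_0)
    then obtain z where z: "poly h z = 0"
      using fundamental_theorem_of_algebra[of h] by (metis constant_degree)
    define V where "V = {p \<in> polys. poly p z = 0}"
    have TV: "q \<in> V" if q: "q \<in> T" for q
    proof -
      obtain c a where "c \<noteq> 0" "smult c q = a * h"
        using minimal_degree_divides[OF T(1) diff mult h q] by blast
      then have "c * poly q z = 0"
        using z by (metis mult_zero_right poly_mult poly_smult)
      then show ?thesis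
        using \<open>c \<noteq> 0\<close> T(1) q by (auto simp: V_def)
    qed
    \<comment> \<open>A minimal-degree \<open>e\<close> in \<open>V\<close> divides everything in
      \<open>V\<close> up to constants, so it suffices to place \<open>e\<close> in \<open>T\<close>
      and cancel the constants by primality.\<close>
    have "q \<in> T" if q: "q \<in> V" for q
    proof -
      obtain e where e: "e \<in> V" "e \<noteq> 0" "\<And>p. p \<in> V \<Longrightarrow> p \<noteq> 0 \<Longrightarrow> degree e \<le> degree p"
        using ex_minimal_degree[of V] TV[OF h(1)] h(2) by blast
      have "degree e \<noteq> 0"
      proof
        assume "degree e = 0"
        then obtain b where "e = [:b:]"
          by (rule degree_eq_zeroE)
        then show False
          using e(1,2) by (simp add: V_def)
      qed
      have div: "\<exists>c a. c \<in> K \<and> c \<noteq> 0 \<and> a \<in> polys \<and> smult c p = a * e" if "p \<in> V" for p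
        by (rule minimal_degree_divides[OF _ _ _ e that])
          (auto simp: V_def polys_diff polys_mult)
      have "e \<in> T"
      \<comment> \<open>A multiple of \<open>h\<close> factors as \<open>a * e\<close>. Since
        \<open>e\<close> is not constant, \<open>a\<close> has smaller degree than \<open>h\<close>
        and lies outside \<open>T\<close>, so primality leaves \<open>e\<close>.\<close>
      proof -
        obtain c a where ca: "c \<in> K" "c \<noteq> 0" "a \<in> polys" "smult c h = a * e"
          using div[OF TV[OF h(1)]] by blast
        have "a * e \<in> T"
          using mult[OF polys_const[OF ca(1)] h(1)] ca(4) by simp
        moreover have "a \<notin> T"
        proof
          assume "a \<in> T"
          have "a \<noteq> 0"
            using ca h(2) by auto
          then have "degree h = degree a + degree e"
            using ca e(2) by (metis degree_mult_eq degree_smult_eq)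
          then show False
            using h(3)[OF \<open>a \<in> T\<close> \<open>a \<noteq> 0\<close>] \<open>degree e \<noteq> 0\<close> by simp
        qed
        ultimately show ?thesis
          using prime[of a e] ca e(1) by (auto simp: V_def)
      qed
      obtain c a where ca: "c \<in> K" "c \<noteq> 0" "a \<in> polys" "smult c q = a * e"
        using div[OF q] by blast
      have "[:c:] * q \<in> T"
        using mult[OF ca(3) \<open>e \<in> T\<close>] ca(4) by simp
      moreover have "[:c:] \<notin> T"
        using const ca(2) by blast
      ultimately show ?thesis
        using prime[of "[:c:]" q] q ca(1) by (auto simp: V_def polys_const)
    qed
    with TV have "q \<in> T \<longleftrightarrow> q \<in> V" for q
      by blast
    then show ?thesis
      by (intro exI[of _ z]) (simp add: V_def)
  qed
qed

section \<open>Prime ideals and complex points\<close>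

definition is_ideal :: "'r::comm_ring_1 set \<Rightarrow> bool" where
  "is_ideal I \<longleftrightarrow> 0 \<in> I \<and> (\<forall>x\<in>I. \<forall>y\<in>I. x + y \<in> I) \<and> (\<forall>r. \<forall>x\<in>I. r * x \<in> I)"

lemma is_idealD:
  assumes "is_ideal I"
  shows "0 \<in> I" "x \<in> I \<Longrightarrow> y \<in> I \<Longrightarrow> x + y \<in> I" "x \<in> I \<Longrightarrow> r * x \<in> I"
    "x \<in> I \<Longrightarrow> y \<in> I \<Longrightarrow> x - y \<in> I"
proof -
  show "x - y \<in> I" if "x \<in> I" "y \<in> I"
    using assms that unfolding is_ideal_def
    by (metis mult_minus1 diff_conv_add_uminus)
qed (use assms in \<open>auto simp: is_ideal_def\<close>)

lemma is_ideal_sum: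
  assumes "is_ideal I" "\<And>i. i \<in> A \<Longrightarrow> g i \<in> I"
  shows "sum g A \<in> I"
  using assms(2) by (induction A rule: infinite_finite_induct) (auto simp: is_idealD[OF assms(1)])

text \<open>For an ideal \<open>I\<close>, this is the ideal generated by \<open>I\<close> and
  \<open>a\<close>.\<close>

definition adjoin_ideal :: "'r::comm_ring_1 set \<Rightarrow> 'r \<Rightarrow> 'r set" where
  "adjoin_ideal I a = {x + r * a | x r. x \<in> I}"

lemma adjoin_ideal:
  assumes "is_ideal I"
  shows "is_ideal (adjoin_ideal I a)" "I \<subseteq> adjoin_ideal I a" "a \<in> adjoin_ideal I a"
proof -
  have "\<exists>x r. 0 = x + r * a \<and> x \<in> I"
    using is_idealD(1)[OF assms] by (intro exI[of _ 0]) auto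
  moreover have "\<exists>x'' r''. (x + r * a) + (x' + r' * a) = x'' + r'' * a \<and> x'' \<in> I"
    if "x \<in> I" "x' \<in> I" for x x' r r'
    using is_idealD(2)[OF assms that]
    by (intro exI[of _ "x + x'"] exI[of _ "r + r'"]) (auto simp: algebra_simps)
  moreover have "\<exists>x'' r''. s * (x + r * a) = x'' + r'' * a \<and> x'' \<in> I" if "x \<in> I" for x r s
    using is_idealD(3)[OF assms that, of s]
    by (intro exI[of _ "s * x"] exI[of _ "s * r"]) (auto simp: algebra_simps)
  ultimately show "is_ideal (adjoin_ideal I a)"
    unfolding is_ideal_def adjoin_ideal_def by blast
  show "I \<subseteq> adjoin_ideal I a"
    unfolding adjoin_ideal_def by (force intro: exI[of _ 0])
  show "a \<in> adjoin_ideal I a"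
    unfolding adjoin_ideal_def using is_idealD(1)[OF assms]
    by clarsimp (metis add_0 mult_1)
qed

text \<open>The quotient by \<open>P\<close> is an integral domain of characteristic 0; the case
  \<open>N = 1\<close> makes \<open>P\<close> proper.\<close>

locale char0_prime_ideal =
  fixes P :: "'r::comm_ring_1 set"
  assumes ideal: "is_ideal P"
    and of_int_notin: "N \<noteq> 0 \<Longrightarrow> of_int N \<notin> P"
    and prime: "x * y \<in> P \<Longrightarrow> x \<in> P \<or> y \<in> P"

text \<open>An ideal maximal among those avoiding the non-zero integers is prime, because these
  integers are closed under multiplication. Zorn's lemma supplies one above
  \<open>I\<close>.\<close>

lemma ex_char0_prime_ideal:
  fixes I :: "'r::comm_ring_1 set"
  assumes I: "is_ideal I" "\<And>N. N \<noteq> 0 \<Longrightarrow> of_int N \<notin> I"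
  shows "\<exists>P. I \<subseteq> P \<and> char0_prime_ideal P"
proof -
  define \<A> where "\<A> = {J. is_ideal J \<and> I \<subseteq> J \<and> (\<forall>N. N \<noteq> 0 \<longrightarrow> of_int N \<notin> J)}"
  have "\<exists>P\<in>\<A>. \<forall>X\<in>\<A>. P \<subseteq> X \<longrightarrow> X = P"
  proof (rule subset_Zorn_nonempty)
    show "\<A> \<noteq> {}"
      using I by (auto simp: \<A>_def)
    fix C assume C: "C \<noteq> {}" "subset.chain \<A> C"
    then have CA: "J \<in> \<A>" if "J \<in> C" for J
      using that by (auto simp: subset.chain_def)
    then have CA_ideal: "is_ideal J" if "J \<in> C" for J
      using that by (auto simp: \<A>_def)
    have "x + y \<in> \<Union>C" if xy: "x \<in> \<Union>C" "y \<in> \<Union>C" for x y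
    proof -
      obtain J where "J \<in> C" "x \<in> J" "y \<in> J"
        using xy C(2) unfolding subset.chain_def by blast
      then show ?thesis
        using CA_ideal is_idealD(2) by blast
    qed
    moreover have "r * x \<in> \<Union>C" if x: "x \<in> \<Union>C" for r x
    proof -
      obtain J where "J \<in> C" "x \<in> J"
        using x by blast
      then show ?thesis
        using CA_ideal is_idealD(3) by blast
    qed
    moreover have "0 \<in> \<Union>C"
      using CA_ideal is_idealD(1) C(1) by blast
    ultimately have "is_ideal (\<Union>C)"
      unfolding is_ideal_def by blast
    then show "\<Union>C \<in> \<A>"
      using CA C(1) by (auto simp: \<A>_def)
  qed
  then obtain P where P: "P \<in> \<A>" "\<And>X. X \<in> \<A> \<Longrightarrow> P \<subseteq> X \<Longrightarrow> X = P"
    by blast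
  have P_ideal: "is_ideal P" and "I \<subseteq> P"
    using P(1) by (auto simp: \<A>_def)
  \<comment> \<open>By maximality, adjoining any \<open>a\<close> outside \<open>P\<close> brings in
    a non-zero integer.\<close>
  have int_adjoin: "\<exists>N x r. N \<noteq> 0 \<and> x \<in> P \<and> of_int N = x + r * a" if "a \<notin> P" for a
  proof -
    have "adjoin_ideal P a \<notin> \<A>"
      using P(2) adjoin_ideal[OF P_ideal] that by blast
    then show ?thesis
      using adjoin_ideal[OF P_ideal, of a] \<open>I \<subseteq> P\<close> unfolding \<A>_def
      by (auto simp: adjoin_ideal_def)
  qed
  have "x \<in> P \<or> y \<in> P" if xy: "x * y \<in> P" for x y
  proof (rule ccontr)
    assume "\<not> (x \<in> P \<or> y \<in> P)"
    then obtain M p r N q s where MN: "M \<noteq> 0" "p \<in> P" "of_int M = p + r * x"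
        "N \<noteq> 0" "q \<in> P" "of_int N = q + s * y"
      using int_adjoin by metis
    \<comment> \<open>In the expanded product of the two representations, every term has a factor
      \<open>p\<close>, \<open>q\<close> or \<open>x * y\<close> from \<open>P\<close>.\<close>
    have "of_int (M * N) = (q + s * y) * p + ((r * x) * q + (r * s) * (x * y))"
      using MN by (simp add: algebra_simps)
    also have "\<dots> \<in> P"
      by (intro is_idealD(2,3)[OF P_ideal] MN xy)
    finally have "of_int (M * N) \<in> P" .
    moreover have "M * N \<noteq> 0"
      using MN by simp
    ultimately show False
      using P(1) unfolding \<A>_def by blast
  qed
  then have "char0_prime_ideal P"
    using P(1) by unfold_locales (auto simp: \<A>_def)
  then show ?thesis
    using \<open>I \<subseteq> P\<close> by blast
qed

section \<open>Partial ring homomorphisms into the complex numbers\<close>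

context char0_prime_ideal
begin

text \<open>
  \<open>G\<close> stands for (the graph of) a ring homomorphism into \<open>\<complex>\<close>, defined modulo \<open>P\<close> on a
  countable subring and with kernel \<open>P\<close> there.
\<close>

definition partial_point :: "('r \<times> complex) set \<Rightarrow> bool" where
  "partial_point G \<longleftrightarrow> (1, 1) \<in> G \<and> countable (snd ` G) \<and>
     (\<forall>(x, w)\<in>G. \<forall>(y, v)\<in>G. (x - y, w - v) \<in> G \<and> (x * y, w * v) \<in> G) \<and>
     (\<forall>(x, w)\<in>G. x \<in> P \<longleftrightarrow> w = 0)"

text \<open>The homomorphism applied to coefficients, kept as a relation: several \<open>p\<close>
  may share one \<open>q\<close>, since \<open>q\<close> fixes the coefficients of \<open>p\<close>
  only modulo \<open>P\<close>.\<close>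

definition paired :: "('r \<times> complex) set \<Rightarrow> 'r poly \<Rightarrow> complex poly \<Rightarrow> bool" where
  "paired G p q \<longleftrightarrow> (\<forall>i. (coeff p i, coeff q i) \<in> G)"

lemma partial_pointD:
  assumes "partial_point G"
  shows "(1, 1) \<in> G" "countable (snd ` G)"
    "(x, w) \<in> G \<Longrightarrow> (y, v) \<in> G \<Longrightarrow> (x - y, w - v) \<in> G"
    "(x, w) \<in> G \<Longrightarrow> (y, v) \<in> G \<Longrightarrow> (x * y, w * v) \<in> G"
    "(x, w) \<in> G \<Longrightarrow> x \<in> P \<longleftrightarrow> w = 0"
    "(0, 0) \<in> G"
    "(x, w) \<in> G \<Longrightarrow> (y, v) \<in> G \<Longrightarrow> (x + y, w + v) \<in> G"
proof -
  show diff: "(x - y, w - v) \<in> G" if "(x, w) \<in> G" "(y, v) \<in> G" for x w y v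
    using assms that unfolding partial_point_def by fast
  show one: "(1, 1) \<in> G"
    using assms by (simp add: partial_point_def)
  show zero: "(0, 0) \<in> G"
    using diff[OF one one] by simp
  show "(x + y, w + v) \<in> G" if "(x, w) \<in> G" "(y, v) \<in> G"
    using diff[OF that(1) diff[OF zero that(2)]] by simp
  show "countable (snd ` G)"
    using assms by (simp add: partial_point_def)
  show "(x * y, w * v) \<in> G" if "(x, w) \<in> G" "(y, v) \<in> G"
    using assms that unfolding partial_point_def by fast
  show "x \<in> P \<longleftrightarrow> w = 0" if "(x, w) \<in> G"
    using assms that unfolding partial_point_def by fast
qed

lemma partial_point_sum:
  assumes "partial_point G" "\<And>i. i \<in> A \<Longrightarrow> (g i, h i) \<in> G"
  shows "(sum g A, sum h A) \<in> G"
  using assms(2)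
  by (induction A rule: infinite_finite_induct) (auto simp: partial_pointD[OF assms(1)])

lemma partial_point_prod:
  assumes "partial_point G" "\<And>i. i \<in> A \<Longrightarrow> (g i, h i) \<in> G"
  shows "(prod g A, prod h A) \<in> G"
  using assms(2)
  by (induction A rule: infinite_finite_induct) (auto simp: partial_pointD[OF assms(1)])

lemma partial_point_power:
  assumes "partial_point G" "(x, w) \<in> G"
  shows "(x ^ n, w ^ n) \<in> G"
  by (induction n) (auto simp: partial_pointD[OF assms(1)] assms(2))

lemma partial_point_of_int:
  assumes "partial_point G"
  shows "(of_int n, of_int n) \<in> G"
proof (induction n rule: int_induct[where k = 0])
  case base
  show ?case using partial_pointD[OF assms] by simp
next
  case (step1 i)
  then show ?case using partial_pointD(7)[OF assms step1(2) partial_pointD(1)[OF assms]] by simp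
next
  case (step2 i)
  then show ?case using partial_pointD(3)[OF assms step2(2) partial_pointD(1)[OF assms]] by simp
qed

lemma paired_diff:
  assumes "partial_point G" "paired G p q" "paired G p' q'"
  shows "paired G (p - p') (q - q')"
  using assms partial_pointD(3)[OF assms(1)] by (simp add: paired_def)

lemma paired_mult:
  assumes "partial_point G" "paired G p q" "paired G p' q'"
  shows "paired G (p * p') (q * q')"
  using assms partial_pointD(4)[OF assms(1)]
  by (auto simp: paired_def coeff_mult intro!: partial_point_sum)

lemma ex_paired:
  assumes G: "partial_point G" and q: "\<And>i. coeff q i \<in> snd ` G"
  shows "\<exists>p. paired G p q"
proof -
  \<comment> \<open>The value \<open>g 0 = 0\<close> is what makes \<open>map_poly g\<close> act on
    every coefficient.\<close>
  define g where "g w = (if w = 0 then 0 else SOME v. (v, w) \<in> G)" for w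
  have "(g w, w) \<in> G" if "w \<in> snd ` G" for w
    using that partial_pointD(6)[OF G] by (auto simp: g_def intro: someI)
  then have "paired G (map_poly g q) q"
    using q by (simp add: paired_def coeff_map_poly g_def)
  then show ?thesis
    by blast
qed

text \<open>\<open>p - p'\<close> is paired with 0, so its coefficients lie in \<open>P\<close>.
  Whether a lift of \<open>q\<close> vanishes at \<open>a\<close> modulo \<open>P\<close> thus
  depends on \<open>q\<close> alone.\<close>

lemma paired_congruent:
  assumes G: "partial_point G" and pq: "paired G p q" "paired G p' q"
    and "poly p a \<in> P"
  shows "poly p' a \<in> P"
proof -
  have "coeff (p - p') i \<in> P" for i
    using paired_diff[OF G pq] partial_pointD(5)[OF G] by (auto simp: paired_def)
  then have "poly (p - p') a \<in> P"
    unfolding poly_altdef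
    by (intro is_ideal_sum[OF ideal]) (metis is_idealD(3)[OF ideal] mult.commute)
  then have "poly p a - poly (p - p') a \<in> P"
    using assms(4) by (intro is_idealD(4)[OF ideal])
  then show ?thesis
    by simp
qed

text \<open>The relations of \<open>a\<close> modulo \<open>P\<close>, transported to complex
  polynomials, form a prime ideal without non-zero constants. Sending \<open>a\<close> to a
  \<open>z\<close> that satisfies exactly these relations keeps the kernel equal to
  \<open>P\<close>.\<close>

lemma extend_partial_point:
  assumes G: "partial_point G"
  shows "\<exists>G' z. partial_point G' \<and> G \<subseteq> G' \<and> (a, z) \<in> G'"
proof -
  note GD = partial_pointD[OF G]
  define K where "K = snd ` G"
  interpret K: subring_of K
  proof
    show "1 \<in> K"
      using GD(1) unfolding K_def by (metis imageI snd_conv)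
    fix w v assume "w \<in> K" "v \<in> K"
    then obtain x y where "(x, w) \<in> G" "(y, v) \<in> G"
      by (auto simp: K_def)
    then have "(x - y, w - v) \<in> G" "(x * y, w * v) \<in> G"
      by (rule GD(3,4))+
    then show "w - v \<in> K" "w * v \<in> K"
      unfolding K_def by (metis imageI snd_conv)+
  qed
  have K_polys: "q \<in> K.polys \<longleftrightarrow> (\<exists>p. paired G p q)" for q :: "complex poly"
  proof
    assume "q \<in> K.polys"
    then show "\<exists>p. paired G p q"
      by (intro ex_paired[OF G]) (simp add: K.polys_def flip: K_def)
  next
    assume "\<exists>p. paired G p q"
    then obtain p where "\<And>i. (coeff p i, coeff q i) \<in> G"
      by (auto simp: paired_def)
    then have "coeff q i \<in> K" for i
      unfolding K_def by (metis imageI snd_conv)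
    then show "q \<in> K.polys"
      by (simp add: K.polys_def)
  qed
  define T where "T = {q. \<exists>p. paired G p q \<and> poly p a \<in> P}"
  have T_iff: "q \<in> T \<longleftrightarrow> poly p a \<in> P" if "paired G p q" for p q
    using that paired_congruent[OF G] by (auto simp: T_def)
  have const: "c = 0" if "[:c:] \<in> T" for c
  proof -
    obtain p where p: "paired G p [:c:]" "poly p a \<in> P"
      using \<open>[:c:] \<in> T\<close> by (auto simp: T_def)
    have c: "(coeff p 0, c) \<in> G"
      using p(1) unfolding paired_def by (metis coeff_pCons_0)
    \<comment> \<open>The lift \<open>p\<close> may have higher coefficients in \<open>P\<close>;
      its constant term alone is another lift of the same constant.\<close>
    then have "paired G [:coeff p 0:] [:c:]"
      using GD(6) by (simp add: paired_def coeff_pCons split: nat.split)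
    then have "coeff p 0 \<in> P"
      using paired_congruent[OF G p(1) _ p(2)] by fastforce
    then show ?thesis
      using GD(5)[OF c] by simp
  qed
  have "\<exists>z. \<forall>q\<in>K.polys. q \<in> T \<longleftrightarrow> poly q z = 0"
  proof (rule prime_ideal_eq_vanishing_polys)
    show "subring_of K" by unfold_locales
    show "countable K" using GD(2) by (simp add: K_def)
    show "T \<subseteq> K.polys" by (auto simp: T_def K_polys)
    show "0 \<in> T"
      using GD(6) is_idealD(1)[OF ideal] by (auto simp: T_def paired_def intro!: exI[of _ 0])
    show "p - q \<in> T" if pq: "p \<in> T" "q \<in> T" for p q
    proof -
      obtain s t where "paired G s p" "poly s a \<in> P" "paired G t q" "poly t a \<in> P"
        using pq by (auto simp: T_def)
      then show ?thesis
        using T_iff[OF paired_diff[OF G, of s p t q]] is_idealD(4)[OF ideal] by simp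
    qed
    show "p * q \<in> T" if pq: "p \<in> K.polys" "q \<in> T" for p q
    proof -
      obtain s t where "paired G s p" "paired G t q" "poly t a \<in> P"
        using pq by (auto simp: T_def K_polys)
      then show ?thesis
        using T_iff[OF paired_mult[OF G, of s p t q]] is_idealD(3)[OF ideal] by simp
    qed
    show "p \<in> T \<or> q \<in> T" if pq: "p \<in> K.polys" "q \<in> K.polys" "p * q \<in> T" for p q
    proof -
      obtain s t where st: "paired G s p" "paired G t q"
        using pq K_polys by blast
      then have "poly s a * poly t a \<in> P"
        using T_iff[OF paired_mult[OF G st]] pq(3) by simp
      then show ?thesis
        using prime T_iff st by blast
    qed
  qed (rule const)
  then obtain z where z: "\<And>q. q \<in> K.polys \<Longrightarrow> q \<in> T \<longleftrightarrow> poly q z = 0"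
    by blast
  \<comment> \<open>This is the graph on the ring generated by \<open>a\<close> over the old domain.
    It has kernel \<open>P\<close> because \<open>poly q z = 0\<close> holds exactly for
    \<open>q\<close> in \<open>T\<close>.\<close>
  define G' where "G' = {(poly p a, poly q z) | p q. paired G p q}"
  have "snd ` G' \<subseteq> (\<lambda>q. poly q z) ` K.polys"
    using K_polys by (fastforce simp: G'_def)
  moreover have "countable K.polys"
    by (rule K.countable_polys) (simp add: K_def GD(2))
  ultimately have "countable (snd ` G')"
    by (meson countable_image countable_subset)
  moreover have "(x - y, w - v) \<in> G' \<and> (x * y, w * v) \<in> G'"
    if xy: "(x, w) \<in> G'" "(y, v) \<in> G'" for x w y v
  proof -
    obtain p q p' q' where "paired G p q" "paired G p' q'"
      and [simp]: "x = poly p a" "w = poly q z" "y = poly p' a" "v = poly q' z"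
      using xy by (auto simp: G'_def)
    then have "paired G (p - p') (q - q')" "paired G (p * p') (q * q')"
      by (auto intro: paired_diff[OF G] paired_mult[OF G])
    then show ?thesis
      unfolding G'_def by (force simp flip: poly_diff poly_mult)
  qed
  moreover have "x \<in> P \<longleftrightarrow> w = 0" if "(x, w) \<in> G'" for x w
    using that T_iff z K_polys by (auto simp: G'_def)
  moreover have GG': "G \<subseteq> G'"
  proof clarify
    fix x w assume "(x, w) \<in> G"
    then have "paired G [:x:] [:w:]"
      using GD(6) by (simp add: paired_def coeff_pCons split: nat.split)
    then show "(x, w) \<in> G'"
      unfolding G'_def by force
  qed
  moreover have "(a, z) \<in> G'"
  proof -
    have "paired G [:0, 1:] [:0, 1:]"
      using GD(1,6) by (simp add: paired_def coeff_pCons split: nat.split)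
    then show ?thesis
      unfolding G'_def by force
  qed
  ultimately have "partial_point G' \<and> G \<subseteq> G' \<and> (a, z) \<in> G'"
    using GD(1) unfolding partial_point_def by blast
  then show ?thesis
    by blast
qed

text \<open>The construction starts from the image of the integers, where the kernel is right
  because \<open>P\<close> contains no non-zero integer.\<close>

lemma ex_partial_point: "\<exists>G. partial_point G"
proof -
  define G :: "('r \<times> complex) set" where "G = range (\<lambda>n::int. (of_int n, of_int n))"
  have "(x - y, w - v) \<in> G \<and> (x * y, w * v) \<in> G" if xy: "(x, w) \<in> G" "(y, v) \<in> G" for x w y v
  proof -
    obtain m n :: int where "x = of_int m" "w = of_int m" "y = of_int n" "v = of_int n"
      using xy by (auto simp: G_def)
    then show ?thesis
      unfolding G_def by (auto simp flip: of_int_diff of_int_mult)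
  qed
  moreover have "(1, 1) \<in> G"
    unfolding G_def by (auto intro!: image_eqI[of _ _ 1])
  moreover have "countable (snd ` G)"
    by (simp add: G_def)
  moreover have "x \<in> P \<longleftrightarrow> w = 0" if xw: "(x, w) \<in> G" for x w
  proof -
    obtain n :: int where "x = of_int n" "w = of_int n"
      using xw by (auto simp: G_def)
    then show ?thesis
      using of_int_notin[of n] is_idealD(1)[OF ideal] by (cases "n = 0") auto
  qed
  ultimately have "partial_point G"
    unfolding partial_point_def by blast
  then show ?thesis
    by blast
qed

text \<open>Adjoining the finitely many coordinates one by one gives a graph that is closed under
  ring operations, so it also contains the values of every polynomial.\<close>

lemma ex_complex_point:
  fixes a :: "'r^'m::finite"
  shows "\<exists>z::complex^'m. \<forall>p. mpoly_eval p a \<in> P \<longleftrightarrow> mpoly_eval p z = 0"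
proof -
  have ex_point: "\<exists>G z. partial_point G \<and> (\<forall>l\<in>L. (a $ l, z l) \<in> G)" if "finite L" for L
    using that
  proof (induction L)
    case empty
    then show ?case using ex_partial_point by auto
  next
    case (insert l L)
    then obtain G z where Gz: "partial_point G" "\<forall>l\<in>L. (a $ l, z l) \<in> G"
      by blast
    obtain G' w where "partial_point G'" "G \<subseteq> G'" "(a $ l, w) \<in> G'"
      using extend_partial_point[OF Gz(1)] by blast
    then show ?case
      using Gz(2) insert.hyps by (intro exI[of _ G'] exI[of _ "z(l := w)"]) auto
  qed
  obtain G z where G: "partial_point G" "\<And>l. (a $ l, z l) \<in> G"
    using ex_point[OF finite] by blast
  have "(mpoly_eval p a, mpoly_eval p (\<chi> l. z l)) \<in> G" for p
    unfolding mpoly_eval_def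
    by (intro partial_point_sum partial_pointD(4)[OF G(1)] partial_point_of_int
        partial_point_prod partial_point_power G(1)) (simp add: G(2))
  then show ?thesis
    using partial_pointD(5)[OF G(1)] by blast
qed

end

section \<open>Polynomials as functions on integer points, and their common divisors\<close>

lemma sum_fun_apply: "(\<Sum>i\<in>A. g i) x = (\<Sum>i\<in>A. g i x)"
  by (induction A rule: infinite_finite_induct) auto

lemma prod_fun_apply: "(\<Prod>i\<in>A. g i) x = (\<Prod>i\<in>A. g i x)"
  by (induction A rule: infinite_finite_induct) auto

lemma power_fun_apply: "(g ^ n) x = g x ^ n"
  by (induction n) auto

lemma of_int_fun_apply: "of_int n x = of_int n"
  by (cases n rule: int_diff_cases) simp

lemma mpoly_eval_fun:
  fixes g :: "('b \<Rightarrow> 'a::comm_ring_1)^'m::finite"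
  shows "mpoly_eval p g x = mpoly_eval p (\<chi> l. (g $ l) x)"
  unfolding mpoly_eval_def sum_fun_apply times_fun_apply prod_fun_apply power_fun_apply
    of_int_fun_apply vec_lambda_beta ..

text \<open>An identity \<open>N = r * f + s * g\<close> between integer-valued functions bounds the
  common divisors at all points at once. Without one, a prime ideal containing both functions would
  yield a common complex zero.\<close>

lemma common_divisors_bounded:
  fixes f g :: "'m::finite int_mpoly"
  assumes no_zero: "\<not> (\<exists>z::complex^'m. mpoly_eval f z = 0 \<and> mpoly_eval g z = 0)"
  shows "\<exists>N. N \<noteq> 0 \<and> (\<forall>(u::int^'m) d. d dvd mpoly_eval f u \<longrightarrow> d dvd mpoly_eval g u \<longrightarrow> d dvd N)"
proof -
  \<comment> \<open>At the tuple of coordinate functions, a polynomial evaluates to the function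
    that it defines on integer points.\<close>
  define X :: "(int^'m \<Rightarrow> int)^'m" where "X = (\<chi> l. (\<lambda>u. u $ l))"
  have eval_X: "mpoly_eval p X u = mpoly_eval p u" for p u
    by (simp add: mpoly_eval_fun X_def)
  have zero_ideal: "is_ideal {0 :: int^'m \<Rightarrow> int}"
    by (simp add: is_ideal_def)
  define If where "If = adjoin_ideal {0} (mpoly_eval f X)"
  define I where "I = adjoin_ideal If (mpoly_eval g X)"
  have If: "is_ideal If" "mpoly_eval f X \<in> If"
    unfolding If_def using adjoin_ideal[OF zero_ideal] by blast+
  have I: "is_ideal I" "mpoly_eval f X \<in> I" "mpoly_eval g X \<in> I"
    unfolding I_def using adjoin_ideal[OF If(1)] If(2) by blast+
  have "\<exists>N. N \<noteq> 0 \<and> of_int N \<in> I"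
  proof (rule ccontr)
    assume "\<nexists>N. N \<noteq> 0 \<and> of_int N \<in> I"
    then obtain P where "I \<subseteq> P" "char0_prime_ideal P"
      using ex_char0_prime_ideal[OF I(1)] by blast
    then show False
      using char0_prime_ideal.ex_complex_point[of P X] I no_zero by blast
  qed
  then obtain N r s where N: "N \<noteq> 0" "of_int N = r * mpoly_eval f X + s * mpoly_eval g X"
    by (auto simp: I_def If_def adjoin_ideal_def)
  have "N = r u * mpoly_eval f u + s u * mpoly_eval g u" for u
    using fun_cong[OF N(2), of u] by (simp add: of_int_fun_apply eval_X)
  then show ?thesis
    using N(1) by (intro exI[of _ N]) (metis dvd_add dvd_mult)
qed

section \<open>Multiplicative dependence\<close>

text \<open>Moving negative exponents to the other side turns the relation into an equality of
  integers, to which divisibility applies. \<open>nat\<close> truncates the exponents of the wrong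
  sign to 0.\<close>

lemma prod_powi_eq_1_iff:
  fixes x :: "'n::finite \<Rightarrow> int"
  assumes "\<And>i. x i \<noteq> 0"
  shows "(\<Prod>i\<in>UNIV. complex_of_int (x i) powi k i) = 1 \<longleftrightarrow>
    (\<Prod>i\<in>UNIV. x i ^ nat (k i)) = (\<Prod>i\<in>UNIV. x i ^ nat (- k i))"
proof -
  have "complex_of_int (x i) powi k i = of_int (x i ^ nat (k i)) / of_int (x i ^ nat (- k i))" for i
    by (auto simp: power_int_def divide_inverse power_inverse)
  then have "(\<Prod>i\<in>UNIV. complex_of_int (x i) powi k i) =
      of_int (\<Prod>i\<in>UNIV. x i ^ nat (k i)) / of_int (\<Prod>i\<in>UNIV. x i ^ nat (- k i))"
    by (simp add: prod_dividef)
  moreover have "(\<Prod>i\<in>UNIV. x i ^ nat (- k i)) \<noteq> 0"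
    using assms by simp
  then have "complex_of_int (\<Prod>i\<in>UNIV. x i ^ nat (- k i)) \<noteq> 0"
    by (subst of_int_eq_0_iff)
  ultimately show ?thesis
    by (simp only: divide_eq_1_iff of_int_eq_iff simp_thms)
qed

text \<open>The prime \<open>p\<close> divides the left product, hence a factor of the right one,
  and there \<open>x i\<close> has exponent 0.\<close>

lemma prime_dvd_other_if_prods_eq:
  fixes x :: "'n::finite \<Rightarrow> int" and a b :: "'n \<Rightarrow> nat"
  assumes "prime p" "p dvd x i" "(\<Prod>j\<in>UNIV. x j ^ a j) = (\<Prod>j\<in>UNIV. x j ^ b j)"
    and "a i > 0" "b i = 0"
  shows "\<exists>j. j \<noteq> i \<and> p dvd x j"
proof -
  have "p dvd x i ^ a i"
    using assms(2,4) by (meson dvd_power dvd_trans)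
  also have "\<dots> dvd (\<Prod>j\<in>UNIV. x j ^ a j)"
    by (intro dvd_prodI) auto
  finally obtain j where "p dvd x j ^ b j"
    using assms(1,3) by (auto simp: prime_dvd_prod_iff)
  then have "p dvd x j" "j \<noteq> i"
    using assms(1,5) by (auto dest: prime_dvd_power)
  then show ?thesis
    by blast
qed

lemma largest_prime_factor_gtD:
  assumes "largest_prime_factor x > enat B" "x \<noteq> 0" "B > 0"
  shows "\<exists>p. prime p \<and> p > int B \<and> p dvd x"
proof -
  \<comment> \<open>The units have \<open>largest_prime_factor\<close> 1 by convention, which does
    not exceed a positive \<open>B\<close>.\<close>
  have "\<bar>x\<bar> \<noteq> 1"
    using assms by (auto simp: largest_prime_factor_def one_enat_def)
  define A where "A = {p::nat. prime p \<and> int p dvd x}"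
  have "A \<subseteq> {..nat \<bar>x\<bar>}"
  proof
    fix p assume "p \<in> A"
    then have "int p \<le> \<bar>x\<bar>"
      using dvd_imp_le_int[OF assms(2), of "int p"] by (simp add: A_def)
    then show "p \<in> {..nat \<bar>x\<bar>}"
      by (simp add: le_nat_iff)
  qed
  then have "finite A"
    using finite_subset by blast
  moreover have "A \<noteq> {}"
  proof -
    obtain p where "prime p" "p dvd x"
      using prime_divisor_exists[of x] assms(2) \<open>\<bar>x\<bar> \<noteq> 1\<close> by auto
    then have "nat p \<in> A"
      by (auto simp: A_def prime_ge_0_int)
    then show ?thesis
      by blast
  qed
  ultimately have "Max A \<in> A"
    by (rule Max_in)
  moreover have "Max A > B"
    using assms \<open>\<bar>x\<bar> \<noteq> 1\<close> by (simp add: largest_prime_factor_def A_def)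
  ultimately show ?thesis
    by (intro exI[of _ "int (Max A)"]) (auto simp: A_def)
qed

lemma finite_max_abs_le: "finite {u::int^'m::finite. max_abs u \<le> R}"
proof -
  have "finite (vec_lambda ` (UNIV \<rightarrow>\<^sub>E {-R..R}) :: (int^'m) set)"
    by (intro finite_imageI finite_PiE) auto
  moreover have "{u::int^'m. max_abs u \<le> R} \<subseteq> vec_lambda ` (UNIV \<rightarrow>\<^sub>E {-R..R})"
  proof
    fix u :: "int^'m" assume "u \<in> {u. max_abs u \<le> R}"
    then have "\<bar>u $ l\<bar> \<le> R" for l
      by (simp add: max_abs_def)
    then have "($) u \<in> UNIV \<rightarrow>\<^sub>E {-R..R}"
      by (auto simp: abs_le_iff minus_le_iff)
    then show "u \<in> vec_lambda ` (UNIV \<rightarrow>\<^sub>E {-R..R})"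
      by (metis imageI vec_nth_inverse)
  qed
  ultimately show ?thesis
    using finite_subset by blast
qed

theorem proposition1p6:
  fixes f :: "'n::finite \<Rightarrow> 'm::finite int_mpoly"
    and S :: "(int^'m) set"
  assumes "\<And>i j. i \<noteq> j \<Longrightarrow>
      \<not> (\<exists>z::complex^'m. mpoly_eval (f i) z = 0 \<and> mpoly_eval (f j) z = 0)"
    and "\<And>i. finite {u \<in> S. mpoly_eval (f i) u \<in> {1, -1}}"
    and "card {i. \<not> largest_prime_factor_tends_to_infinity (mpoly_eval (f i)) S} \<le> 1"
  shows "finite {u \<in> S. mult_dependent (\<chi> i. complex_of_int (mpoly_eval (f i) u))}"
proof -
  define good where "good i \<longleftrightarrow> largest_prime_factor_tends_to_infinity (mpoly_eval (f i)) S" for i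
  have "\<exists>N. N \<noteq> 0 \<and> (\<forall>(u::int^'m) d. d dvd mpoly_eval (f i) u \<longrightarrow>
      d dvd mpoly_eval (f j) u \<longrightarrow> d dvd N)"
    if "i \<noteq> j" for i j
    using common_divisors_bounded[OF assms(1)[OF that]] .
  then obtain N where N: "\<And>i j. i \<noteq> j \<Longrightarrow> N i j \<noteq> 0"
      "\<And>i j (u::int^'m) d. i \<noteq> j \<Longrightarrow> d dvd mpoly_eval (f i) u \<Longrightarrow> d dvd mpoly_eval (f j) u \<Longrightarrow> d dvd N i j"
    by metis
  \<comment> \<open>The sum dominates every \<open>N i j\<close>; adding 1 makes the bound strict
    and \<open>B\<close> positive, as the growth condition requires.\<close>
  define B where "B = nat (\<Sum>i\<in>UNIV. \<Sum>j\<in>UNIV. \<bar>N i j\<bar>) + 1"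
  have NB: "\<bar>N i j\<bar> < int B" for i j
  proof -
    have "\<bar>N i j\<bar> \<le> (\<Sum>j\<in>UNIV. \<bar>N i j\<bar>)"
      by (intro member_le_sum) auto
    also have "\<dots> \<le> (\<Sum>i\<in>UNIV. \<Sum>j\<in>UNIV. \<bar>N i j\<bar>)"
      by (intro member_le_sum[where f = "\<lambda>i. \<Sum>j\<in>UNIV. \<bar>N i j\<bar>"]) (auto intro: sum_nonneg)
    finally show ?thesis
      unfolding B_def by linarith
  qed
  have "B > 0"
    by (simp add: B_def)
  have no_common: False if "i \<noteq> j" "p > int B" "p dvd mpoly_eval (f i) u" "p dvd mpoly_eval (f j) u"
    for i j p u
    using dvd_imp_le_int[OF N(1)[OF that(1)] N(2)[OF that(1,3,4)]] NB[of i j] that(2)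
    by linarith
  have "\<exists>R. \<forall>u\<in>S. max_abs u > R \<longrightarrow> largest_prime_factor (mpoly_eval (f i) u) > enat B" if "good i" for i
    using that \<open>B > 0\<close> unfolding good_def largest_prime_factor_tends_to_infinity_def by blast
  then obtain R where R: "\<And>i u. good i \<Longrightarrow> u \<in> S \<Longrightarrow> max_abs u > R i \<Longrightarrow>
      largest_prime_factor (mpoly_eval (f i) u) > enat B"
    by metis
  define R' where "R' = Max (range R)"
  have R': "R i \<le> R'" for i
    by (simp add: R'_def)
  have "\<exists>i. mpoly_eval (f i) u \<in> {1, -1}"
    if u: "u \<in> S" "max_abs u > R'"
      and dep: "mult_dependent (\<chi> i. complex_of_int (mpoly_eval (f i) u))" for u
  proof -
    define x where "x i = mpoly_eval (f i) u" for i
    obtain k :: "int^'n" where x0: "\<And>i. x i \<noteq> 0" and "k \<noteq> 0"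
      and k: "(\<Prod>i\<in>UNIV. x i ^ nat (k $ i)) = (\<Prod>i\<in>UNIV. x i ^ nat (- k $ i))"
      using dep prod_powi_eq_1_iff[of x] unfolding mult_dependent_def x_def[symmetric]
      by auto
    \<comment> \<open>A prime above \<open>B\<close> dividing \<open>x i\<close> divides no other
      coordinate, whereas a non-zero exponent at \<open>i\<close> would force it to.\<close>
    have k_good: "k $ i = 0" if "good i" for i
    proof (rule ccontr)
      assume "k $ i \<noteq> 0"
      have "largest_prime_factor (x i) > enat B"
        unfolding x_def using R'[of i] u by (intro R[OF that]) auto
      then obtain p where p: "prime p" "p > int B" "p dvd x i"
        using largest_prime_factor_gtD[OF _ x0 \<open>B > 0\<close>] by blast
      obtain j where "j \<noteq> i" "p dvd x j"
      \<comment> \<open>The sign of \<open>k $ i\<close> decides which of the two products contains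
        \<open>x i\<close>.\<close>
      proof (cases "k $ i > 0")
        case True
        then show ?thesis
          using that prime_dvd_other_if_prods_eq[OF p(1,3) k] by auto
      next
        case False
        then show ?thesis
          using that prime_dvd_other_if_prods_eq[OF p(1,3) k[symmetric]] \<open>k $ i \<noteq> 0\<close> by auto
      qed
      then show False
        using no_common p unfolding x_def by blast
    qed
    obtain i where i: "k $ i \<noteq> 0"
      using \<open>k \<noteq> 0\<close> by (auto simp: vec_eq_iff)
    \<comment> \<open>By \<open>k_good\<close> the index \<open>i\<close> is exceptional. A second
      exceptional index would contradict the cardinality hypothesis.\<close>
    have k0: "k $ j = 0" if "j \<noteq> i" for j
    proof (cases "good j")
      case False
      then have "{i, j} \<subseteq> {i. \<not> good i}"
        using i k_good by auto
      then have "card {i, j} \<le> 1"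
        using assms(3) card_mono[of "{i. \<not> good i}"] unfolding good_def
        by (meson finite le_trans)
      then show ?thesis
        using that by simp
    qed (use k_good in blast)
    have "(\<Prod>j\<in>UNIV. x j ^ nat (k $ j)) = (\<Prod>j\<in>{i}. x j ^ nat (k $ j))"
      "(\<Prod>j\<in>UNIV. x j ^ nat (- k $ j)) = (\<Prod>j\<in>{i}. x j ^ nat (- k $ j))"
      by (rule prod.mono_neutral_right; simp add: k0)+
    with k have "x i ^ nat (k $ i) = x i ^ nat (- k $ i)"
      by simp
    \<comment> \<open>One of the two exponents is 0 and the other is the absolute value of
      \<open>k $ i\<close>, so \<open>x i\<close> is a unit.\<close>
    then have "x i ^ nat \<bar>k $ i\<bar> = 1"
      using i by (cases "k $ i > 0") auto
    then have "x i dvd 1"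
      using dvd_power[of "nat \<bar>k $ i\<bar>" "x i"] i by simp
    then have "\<bar>x i\<bar> = 1"
      by simp
    then show ?thesis
      unfolding x_def by (intro exI[of _ i]) auto
  qed
  \<comment> \<open>Dependent points in the box are finite in number; those outside it have a
    coordinate \<plusminus>1, which hypothesis (2) controls.\<close>
  then have "u \<in> {u. max_abs u \<le> R'} \<union> (\<Union>i. {u \<in> S. mpoly_eval (f i) u \<in> {1, -1}})"
    if "u \<in> S" "mult_dependent (\<chi> i. complex_of_int (mpoly_eval (f i) u))" for u
    using that by (cases "max_abs u \<le> R'") (simp_all add: not_le)
  then have "{u \<in> S. mult_dependent (\<chi> i. complex_of_int (mpoly_eval (f i) u))} \<subseteq>
      {u. max_abs u \<le> R'} \<union> (\<Union>i. {u \<in> S. mpoly_eval (f i) u \<in> {1, -1}})"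
    by blast
  moreover have "finite \<dots>"
    using assms(2) finite_max_abs_le by auto
  ultimately show ?thesis
    using finite_subset by blast
qed

end
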